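(* Let $\Lambda$ be a non-atomic Radon probability measure on $[0,1]$ with full topological support, let $\mathscr{U}(x):=\Lambda([0,x])$, and let $\mathcal{F}$ be the set of continuous functions $f:[0,1]\to\mathbb{R}$ such that $f\circ\mathscr{U}^{-1}$ is absolutely continuous and $\nabla(f\circ\mathscr{U}^{-1})\in L^2(\mathrm{d}x)$. Let $\alpha\in(0,1]$. Then there exists a non-constant $\alpha$-Hölder continuous function $f\in\mathcal{F}$ if and only if $\Lambda$ is generalized $\alpha$-Frostman.
   Context: $\mathrm{d}x$ is the Lebesgue measure on $[0,1]$ and $\nabla h$ is the weak derivative of an absolutely continuous $h:[0,1]\to\mathbb{R}$. Since $\Lambda$ is non-atomic with full topological support (positive on non-empty relatively open subsets of $[0,1]$), $\mathscr{U}:[0,1]\to[0,1]$ is an increasing homeomorphism. The set $\mathcal{F}$ is the domain of the Dirichlet form $\mathcal{E}(f,g):=\int_0^1\nabla(f\circ\mathscr{U}^{-1})\cdot\nabla(g\circ\mathscr{U}^{-1})\,\mathrm{d}x$. A function $f:[0,1]\to\mathbb{R}$ is $\alpha$-Hölder continuous if there is $K>0$ with $|f(x)-f(y)|\le K|x-y|^\alpha$ for all $x,y\in[0,1]$. Balls are $B(x,r):=\{y\in[0,1]:|x-y|<r\}$. A Radon measure $\nu$ on $[0,1]$ is generalized $\alpha$-Frostman if there is a Borel set $E\subset[0,1]$ with $\nu(E)>0$ such that $\limsup_{r\downarrow0}\frac{\nu(B(x,r))}{r^\alpha}<\infty$ for all $x\in E$. *)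

theory Defs
  imports "HOL-Probability.Probability"
begin

text \<open>Functions and measures on \<open>[0,1]\<close>: a function \<open>[0,1] \<rightarrow> \<real>\<close> is represented by a total function
  \<open>real \<Rightarrow> real\<close> of which only the values on \<open>{0..1}\<close> are used; a measure on \<open>[0,1]\<close> lives on the
  trace of the Borel sets of the real line.\<close>

subsection \<open>Measures\<close>

definition radon_measure_on :: "real set \<Rightarrow> real measure \<Rightarrow> bool" where
  "radon_measure_on X M \<longleftrightarrow>
     sets M = sets (restrict_space borel X) \<and>
     (\<forall>K. compact K \<and> K \<subseteq> X \<longrightarrow> emeasure M K < \<infinity>) \<and>
     (\<forall>A\<in>sets M. emeasure M A = (SUP K\<in>{K. compact K \<and> K \<subseteq> A}. emeasure M K))"

definition non_atomic :: "'a measure \<Rightarrow> bool" where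
  "non_atomic M \<longleftrightarrow>
     (\<forall>A\<in>sets M. 0 < emeasure M A \<longrightarrow>
        (\<exists>B\<in>sets M. B \<subseteq> A \<and> 0 < emeasure M B \<and> emeasure M B < emeasure M A))"

definition full_support_on :: "real set \<Rightarrow> real measure \<Rightarrow> bool" where
  "full_support_on X M \<longleftrightarrow>
     (\<forall>V. openin (top_of_set X) V \<and> V \<noteq> {} \<longrightarrow> 0 < emeasure M V)"

definition generalized_frostman :: "real \<Rightarrow> real measure \<Rightarrow> bool" where
  "generalized_frostman \<alpha> \<nu> \<longleftrightarrow>
     (\<exists>E\<in>sets borel. E \<subseteq> {0..1} \<and> 0 < emeasure \<nu> E \<and>
        (\<forall>x\<in>E. Limsup (at_right 0)
           (\<lambda>r. emeasure \<nu> {y\<in>{0..1}. \<bar>x - y\<bar> < r} / ennreal (r powr \<alpha>)) < \<infinity>))"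

subsection \<open>Functions\<close>

definition holder_continuous :: "real \<Rightarrow> (real \<Rightarrow> real) \<Rightarrow> bool" where
  "holder_continuous \<alpha> f \<longleftrightarrow>
     (\<exists>K>0. \<forall>x\<in>{0..1}. \<forall>y\<in>{0..1}. \<bar>f x - f y\<bar> \<le> K * \<bar>x - y\<bar> powr \<alpha>)"

text \<open>Not to be confused with \<open>absolutely_continuous\<close> of the library, which relates two measures.\<close>

definition absolutely_continuous_fun :: "real \<Rightarrow> real \<Rightarrow> (real \<Rightarrow> real) \<Rightarrow> bool" where
  "absolutely_continuous_fun c d h \<longleftrightarrow>
     (\<forall>\<epsilon>>0. \<exists>\<delta>>0. \<forall>(n::nat) a b.
        (\<forall>i<n. c \<le> a i \<and> a i \<le> b i \<and> b i \<le> d) \<and>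
        disjoint_family_on (\<lambda>i. {a i<..<b i}) {..<n} \<and>
        (\<Sum>i<n. b i - a i) < \<delta> \<longrightarrow>
        (\<Sum>i<n. \<bar>h (b i) - h (a i)\<bar>) < \<epsilon>)"

text \<open>The space of smooth functions with compact support in \<open>S\<close>.\<close>

definition test_functions :: "real set \<Rightarrow> (real \<Rightarrow> real) set" where
  "test_functions S =
     {\<phi>. (\<forall>n x. (deriv ^^ n) \<phi> field_differentiable (at x)) \<and>
         compact (closure {x. \<phi> x \<noteq> 0}) \<and> closure {x. \<phi> x \<noteq> 0} \<subseteq> S}"

definition locally_integrable_on :: "(real \<Rightarrow> real) \<Rightarrow> real set \<Rightarrow> bool" where
  "locally_integrable_on g S \<longleftrightarrow> (\<forall>K. compact K \<and> K \<subseteq> S \<longrightarrow> set_integrable lebesgue K g)"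

text \<open>\<open>has_weak_derivative_on h g S\<close>: on the open set \<open>S\<close>, \<open>g\<close> is a version of the weak derivative
  of \<open>h\<close>, which is determined almost everywhere.\<close>

definition has_weak_derivative_on :: "(real \<Rightarrow> real) \<Rightarrow> (real \<Rightarrow> real) \<Rightarrow> real set \<Rightarrow> bool" where
  "has_weak_derivative_on h g S \<longleftrightarrow>
     locally_integrable_on h S \<and> locally_integrable_on g S \<and>
     (\<forall>\<phi>\<in>test_functions S.
        (LINT x:S|lebesgue. h x * deriv \<phi> x) = - (LINT x:S|lebesgue. g x * \<phi> x))"

definition square_integrable :: "'a measure \<Rightarrow> ('a \<Rightarrow> real) \<Rightarrow> bool" where
  "square_integrable M g \<longleftrightarrow> g \<in> borel_measurable M \<and> integrable M (\<lambda>x. (g x)\<^sup>2)"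

subsection \<open>The scale function and the domain of the Dirichlet form\<close>

definition scale_fun :: "real measure \<Rightarrow> real \<Rightarrow> real" where
  "scale_fun \<Lambda> x = measure \<Lambda> {0..x}"

definition scale_inv :: "real measure \<Rightarrow> real \<Rightarrow> real" where
  "scale_inv \<Lambda> = inv_into {0..1} (scale_fun \<Lambda>)"

definition form_domain :: "real measure \<Rightarrow> (real \<Rightarrow> real) set" where
  "form_domain \<Lambda> =
     {f. continuous_on {0..1} f \<and>
         absolutely_continuous_fun 0 1 (f \<circ> scale_inv \<Lambda>) \<and>
         (\<exists>g. has_weak_derivative_on (f \<circ> scale_inv \<Lambda>) g {0<..<1} \<and>
              square_integrable (lebesgue_on {0..1}) g)}"

end

theory Submission
  imports Defs
begin

text \<open>
  Write \<open>U\<close> for the scale function, \<open>V\<close> for its inverse, and call \<open>x\<close> a Hoelder point of \<open>U\<close> if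
  \<open>|U y - U x| \<le> C * |y - x| powr \<alpha>\<close> for some \<open>C\<close> and all \<open>y\<close>. Since \<open>U y - U x\<close> is the mass of the
  interval between \<open>x\<close> and \<open>y\<close>, the Hoelder points are exactly the points at which the limit superior in
  the Frostman condition is finite (\<open>limsup_finite_iff_scale_holder_point\<close>). For a fixed constant they
  form a compact set, so \<open>\<Lambda>\<close> is generalized Frostman iff for some constant this compact set has
  positive mass (\<open>generalized_frostman_iff\<close>). The change of variables \<open>t = U x\<close> turns \<open>\<Lambda>\<close>
  into Lebesgue measure (\<open>emeasure_scale_image\<close>), and the theorem becomes a comparison of increments of
  \<open>f\<close> with increments of \<open>U\<close>.

  If a compact set \<open>P\<close> of Hoelder points with a common constant has positive mass, then
  \<open>f x = \<Lambda> (P \<inter> [0, x])\<close> is not constant. Its composition with \<open>V\<close> is the primitive of an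
  indicator, which lies in \<open>L\<^sup>2\<close> (\<open>primitive_has_weak_derivative\<close>). It grows only on intervals that
  contain a point of \<open>P\<close>, where \<open>U\<close>, and with it \<open>f\<close>, is \<open>\<alpha>\<close>-Hoelder.

  Conversely let \<open>f\<close> be \<open>\<alpha>\<close>-Hoelder, and let \<open>f \<circ> V\<close> be absolutely continuous. At a point that is
  not a Hoelder point of \<open>U\<close>, the scale \<open>U\<close> oscillates much faster than \<open>f\<close> along some sequence, so
  \<open>f \<circ> V\<close> has arbitrarily short secants of arbitrarily small slope at the corresponding \<open>t\<close>. If almost
  every point is of this kind, then \<open>f \<circ> V\<close> is constant by a Vitali covering argument
  (\<open>absolutely_continuous_fun_flat_imp_eq\<close>).
\<close>

section \<open>Absolutely continuous functions with flat secants\<close>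

lemma lipschitz_imp_absolutely_continuous_fun:
  assumes lip: "\<And>s t. s \<in> {a..b} \<Longrightarrow> t \<in> {a..b} \<Longrightarrow> \<bar>h t - h s\<bar> \<le> \<bar>t - s\<bar>"
  shows "absolutely_continuous_fun a b h"
  unfolding absolutely_continuous_fun_def
proof (intro allI impI, rule exI, intro conjI allI impI)
  fix \<epsilon> :: real and n :: nat and p q :: "nat \<Rightarrow> real"
  assume "0 < \<epsilon>"
  then show "0 < \<epsilon>" .
  assume *: "(\<forall>i<n. a \<le> p i \<and> p i \<le> q i \<and> q i \<le> b) \<and>
       disjoint_family_on (\<lambda>i. {p i<..<q i}) {..<n} \<and> (\<Sum>i<n. q i - p i) < \<epsilon>"
  have "(\<Sum>i<n. \<bar>h (q i) - h (p i)\<bar>) \<le> (\<Sum>i<n. q i - p i)"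
  proof (rule sum_mono)
    fix i assume "i \<in> {..<n}"
    then have "a \<le> p i" "p i \<le> q i" "q i \<le> b" using * by auto
    then show "\<bar>h (q i) - h (p i)\<bar> \<le> q i - p i" using lip[of "p i" "q i"] by auto
  qed
  then show "(\<Sum>i<n. \<bar>h (q i) - h (p i)\<bar>) < \<epsilon>" using * by linarith
qed

lemma absolutely_continuous_fun_mono:
  assumes "absolutely_continuous_fun a b h" "a \<le> c" "d \<le> b"
  shows "absolutely_continuous_fun c d h"
  unfolding absolutely_continuous_fun_def
proof (intro allI impI)
  fix \<epsilon> :: real assume "0 < \<epsilon>"
  from assms(1)[unfolded absolutely_continuous_fun_def, rule_format, OF this]
  obtain \<delta> where "\<delta> > 0" and \<delta>: "\<forall>(n::nat) p q. (\<forall>i<n. a \<le> p i \<and> p i \<le> q i \<and> q i \<le> b)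
      \<and> disjoint_family_on (\<lambda>i. {p i<..<q i}) {..<n} \<and> (\<Sum>i<n. q i - p i) < \<delta>
      \<longrightarrow> (\<Sum>i<n. \<bar>h (q i) - h (p i)\<bar>) < \<epsilon>"
    by (elim exE conjE) (rule that)
  have imp: "(\<forall>i<n. a \<le> p i \<and> p i \<le> q i \<and> q i \<le> b)"
    if "(\<forall>i<n. c \<le> p i \<and> p i \<le> q i \<and> q i \<le> d)" for n :: nat and p q :: "nat \<Rightarrow> real"
    using that assms(2,3) by (meson order_trans)
  have "\<forall>(n::nat) p q. (\<forall>i<n. c \<le> p i \<and> p i \<le> q i \<and> q i \<le> d)
      \<and> disjoint_family_on (\<lambda>i. {p i<..<q i}) {..<n} \<and> (\<Sum>i<n. q i - p i) < \<delta>
      \<longrightarrow> (\<Sum>i<n. \<bar>h (q i) - h (p i)\<bar>) < \<epsilon>"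
    by (intro allI impI, elim conjE) (intro \<delta>[rule_format] conjI imp)
  with \<open>\<delta> > 0\<close> show "\<exists>\<delta>>0. \<forall>(n::nat) p q. (\<forall>i<n. c \<le> p i \<and> p i \<le> q i \<and> q i \<le> d)
      \<and> disjoint_family_on (\<lambda>i. {p i<..<q i}) {..<n} \<and> (\<Sum>i<n. q i - p i) < \<delta>
      \<longrightarrow> (\<Sum>i<n. \<bar>h (q i) - h (p i)\<bar>) < \<epsilon>"
    by (intro exI conjI)
qed

text \<open>Finitely many disjoint closed intervals cut \<open>[a, b]\<close> into themselves and finitely many gaps, and the
  triangle inequality splits the increment of \<open>h\<close> accordingly. The gaps are produced as a finite
  sequence, the form in which absolute continuity can be applied to them. The induction adds the
  intervals from left to right: the one with the largest left endpoint \<open>l m\<close> lies to the right of all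
  others, so the hypothesis applies to \<open>[a, l m]\<close>, and the only new gap is \<open>[r m, b]\<close>.\<close>

lemma increment_le_intervals_plus_gaps:
  fixes h :: "real \<Rightarrow> real" and l r :: "'i \<Rightarrow> real"
  assumes "finite C" and "a \<le> b"
    and "\<And>i. i \<in> C \<Longrightarrow> a \<le> l i \<and> l i < r i \<and> r i \<le> b"
    and "pairwise (\<lambda>i j. disjnt {l i..r i} {l j..r j}) C"
  shows "\<exists>(n::nat) p q. (\<forall>i<n. a \<le> p i \<and> p i \<le> q i \<and> q i \<le> b)
           \<and> disjoint_family_on (\<lambda>i. {p i<..<q i}) {..<n}
           \<and> (\<Sum>i<n. q i - p i) = (b - a) - (\<Sum>i\<in>C. r i - l i)
           \<and> \<bar>h b - h a\<bar> \<le> (\<Sum>i\<in>C. \<bar>h (r i) - h (l i)\<bar>) + (\<Sum>i<n. \<bar>h (q i) - h (p i)\<bar>)"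
  using assms
proof (induction arbitrary: b rule: finite_ranking_induct[where f = l])
  case empty
  then show ?case
    \<comment> \<open>The whole of \<open>[a, b]\<close> is one gap.\<close>
    by (intro exI[of _ 1] exI[of _ "\<lambda>_. a"] exI[of _ "\<lambda>_. b"]) (auto simp: disjoint_family_on_def)
next
  case (insert m S)
  show ?case
  proof (cases "m \<in> S")
    case True
    then show ?thesis using insert by (simp add: insert_absorb)
  next
    case False
    have m: "a \<le> l m" "l m < r m" "r m \<le> b" using insert.prems(2)[of m] by auto
    have left: "r i < l m" if "i \<in> S" for i
    proof (rule ccontr)
      assume "\<not> r i < l m"
      then have "l m \<in> {l i..r i} \<inter> {l m..r m}" using insert.hyps(2)[OF that] m by auto
      moreover have "disjnt {l i..r i} {l m..r m}"
        using that False by (intro pairwiseD[OF insert.prems(3)]) auto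
      ultimately show False unfolding disjnt_def by blast
    qed
    have "\<exists>(n::nat) p q. (\<forall>i<n. a \<le> p i \<and> p i \<le> q i \<and> q i \<le> l m)
           \<and> disjoint_family_on (\<lambda>i. {p i<..<q i}) {..<n}
           \<and> (\<Sum>i<n. q i - p i) = (l m - a) - (\<Sum>i\<in>S. r i - l i)
           \<and> \<bar>h (l m) - h a\<bar> \<le> (\<Sum>i\<in>S. \<bar>h (r i) - h (l i)\<bar>) + (\<Sum>i<n. \<bar>h (q i) - h (p i)\<bar>)"
    proof (rule insert.IH)
      show "a \<le> l m" by (rule m)
      show "a \<le> l i \<and> l i < r i \<and> r i \<le> l m" if "i \<in> S" for i
        using insert.prems(2)[of i] left[OF that] that by auto
      show "pairwise (\<lambda>i j. disjnt {l i..r i} {l j..r j}) S"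
        using insert.prems(3) by (rule pairwise_subset) auto
    qed
    then obtain n :: nat and p q where
      pq: "\<And>i. i < n \<Longrightarrow> a \<le> p i \<and> p i \<le> q i \<and> q i \<le> l m"
      and dis: "disjoint_family_on (\<lambda>i. {p i<..<q i}) {..<n}"
      and len: "(\<Sum>i<n. q i - p i) = (l m - a) - (\<Sum>i\<in>S. r i - l i)"
      and inc: "\<bar>h (l m) - h a\<bar> \<le> (\<Sum>i\<in>S. \<bar>h (r i) - h (l i)\<bar>) + (\<Sum>i<n. \<bar>h (q i) - h (p i)\<bar>)"
      by blast
    let ?p = "p(n := r m)" and ?q = "q(n := b)"
    have 1: "a \<le> ?p i \<and> ?p i \<le> ?q i \<and> ?q i \<le> b" if "i < Suc n" for i
      using that pq[of i] m by (auto simp: less_Suc_eq)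
    have 2: "disjoint_family_on (\<lambda>i. {?p i<..<?q i}) {..<Suc n}"
    proof -
      have "x \<notin> {p i<..<q i}" if "i < n" "x \<in> {r m<..<b}" for i x
        using pq[OF that(1)] m that(2) by auto
      then have "{r m<..<b} \<inter> (\<Union>i<n. {?p i<..<?q i}) = {}"
        by (auto simp del: greaterThanLessThan_iff)
      moreover have "disjoint_family_on (\<lambda>i. {?p i<..<?q i}) {..<n}"
        using dis unfolding disjoint_family_on_def by simp
      ultimately show ?thesis
        by (simp add: lessThan_Suc disjoint_family_on_insert del: UN_simps)
    qed
    have 3: "(\<Sum>i<Suc n. ?q i - ?p i) = (b - a) - (\<Sum>i\<in>insert m S. r i - l i)"
      using len insert.hyps(1) False by simp
    have 4: "\<bar>h b - h a\<bar> \<le> (\<Sum>i\<in>insert m S. \<bar>h (r i) - h (l i)\<bar>) + (\<Sum>i<Suc n. \<bar>h (?q i) - h (?p i)\<bar>)"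
      using inc insert.hyps(1) False by simp
    show ?thesis
      by (rule exI[of _ "Suc n"], rule exI[of _ ?p], rule exI[of _ ?q], intro conjI allI impI 2 3 4) (use 1 in blast)+
  qed
qed

text \<open>For a given \<open>c > 0\<close>, the intervals on which the increment of \<open>h\<close> is at most \<open>c\<close> times the length
  form a Vitali cover of almost all of \<open>(a, b)\<close>, so finitely many disjoint ones exhaust \<open>[a, b]\<close> up to a
  set of small measure. Over these intervals \<open>h\<close> changes by at most \<open>c * (b - a)\<close>, over the gaps by
  little because of absolute continuity.\<close>

lemma absolutely_continuous_fun_flat_imp_eq:
  assumes ac: "absolutely_continuous_fun a b h" and "a \<le> b" and N: "negligible N"
    and flat: "\<And>t c d. t \<in> {a<..<b} - N \<Longrightarrow> 0 < c \<Longrightarrow> 0 < d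
                 \<Longrightarrow> \<exists>s. s \<noteq> t \<and> \<bar>s - t\<bar> < d \<and> \<bar>h s - h t\<bar> \<le> c * \<bar>s - t\<bar>"
  shows "h b = h a"
proof -
  have bound: "\<bar>h b - h a\<bar> \<le> c * (b - a) + \<epsilon>" if c: "0 < c" and "0 < \<epsilon>" for c \<epsilon> :: real
  proof -
    obtain \<delta> where "\<delta> > 0" and \<delta>: "\<forall>(n::nat) p q. (\<forall>i<n. a \<le> p i \<and> p i \<le> q i \<and> q i \<le> b)
        \<and> disjoint_family_on (\<lambda>i. {p i<..<q i}) {..<n} \<and> (\<Sum>i<n. q i - p i) < \<delta>
        \<longrightarrow> (\<Sum>i<n. \<bar>h (q i) - h (p i)\<bar>) < \<epsilon>"
      using ac[unfolded absolutely_continuous_fun_def, rule_format, OF \<open>0 < \<epsilon>\<close>]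
      by (elim exE conjE) (rule that)
    define K where "K = {(l, r). a \<le> l \<and> l < r \<and> r \<le> b \<and> \<bar>h r - h l\<bar> \<le> c * (r - l)}"
    have Kpos: "0 < (snd i - fst i) / 2" if "i \<in> K" for i
      using that by (auto simp: K_def)
    \<comment> \<open>The covering theorem speaks of closed balls; a closed interval is one around its midpoint.\<close>
    have cb: "cball ((fst i + snd i) / 2) ((snd i - fst i) / 2) = {fst i..snd i}" for i :: "real \<times> real"
      by (simp add: cball_eq_atLeastAtMost field_simps)
    have fine: "\<exists>i. i \<in> K \<and> t \<in> cball ((fst i + snd i) / 2) ((snd i - fst i) / 2)
                     \<and> (snd i - fst i) / 2 < d"
      if t: "t \<in> {a<..<b} - N" and "0 < d" for t d
    proof -
      \<comment> \<open>The bound on the length keeps the secant inside \<open>[a, b]\<close>.\<close>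
      have "0 < min d (min (t - a) (b - t))" using that by auto
      from flat[OF t c this] obtain s where s: "s \<noteq> t" "\<bar>s - t\<bar> < d" "\<bar>s - t\<bar> < t - a"
        "\<bar>s - t\<bar> < b - t" "\<bar>h s - h t\<bar> \<le> c * \<bar>s - t\<bar>" by auto
      have "(min s t, max s t) \<in> K" using s by (auto simp: K_def min_def max_def abs_minus_commute)
      moreover have "t \<in> {min s t..max s t}" "(max s t - min s t) / 2 < d" using s by auto
      ultimately show ?thesis unfolding cb by force
    qed
    obtain C where C: "countable C" "C \<subseteq> K"
      and disj: "pairwise (\<lambda>i j. disjnt {fst i..snd i} {fst j..snd j}) C"
      and cover: "negligible ({a<..<b} - N - (\<Union>i\<in>C. {fst i..snd i}))"
      using Vitali_covering_theorem_cballs[of K "\<lambda>i. (snd i - fst i) / 2" "{a<..<b} - N"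
          "\<lambda>i. (fst i + snd i) / 2", OF Kpos fine] unfolding cb by auto
    let ?I = "\<lambda>i::real \<times> real. {fst i..snd i}"
    have sub: "?I i \<subseteq> {a..b}" if "i \<in> C" for i using that C by (auto simp: K_def)
    have Usub: "(\<Union>i\<in>C. ?I i) \<subseteq> {a..b}" using sub by blast
    have Um: "(\<Union>i\<in>C. ?I i) \<in> lmeasurable"
      by (rule lmeasurable_interval(1)[of a b, THEN fmeasurableI2]) (use Usub C in \<open>auto intro!: sets.countable_UN'\<close>)
    have full: "measure lebesgue (\<Union>i\<in>C. ?I i) = b - a"
    proof -
      have "negligible (insert a (insert b (N \<union> ({a<..<b} - N - (\<Union>i\<in>C. ?I i)))))"
        using N cover by (simp add: negligible_Un)
      then have "negligible ({a..b} - (\<Union>i\<in>C. ?I i) \<union> ((\<Union>i\<in>C. ?I i) - {a..b}))"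
      proof (rule negligible_subset)
        have "{a..b} \<subseteq> insert a (insert b {a<..<b})" by auto
        then show "{a..b} - (\<Union>i\<in>C. ?I i) \<union> ((\<Union>i\<in>C. ?I i) - {a..b})
            \<subseteq> insert a (insert b (N \<union> ({a<..<b} - N - (\<Union>i\<in>C. ?I i))))"
          using Usub by blast
      qed
      then have "measure lebesgue (\<Union>i\<in>C. ?I i) = measure lebesgue {a..b}"
        by (rule measure_negligible_symdiff[OF lmeasurable_interval(1)])
      then show ?thesis using \<open>a \<le> b\<close> by simp
    qed
    obtain D where D: "D \<subseteq> ?I ` C" "finite D" "b - a - \<delta> < measure lebesgue (\<Union>D)"
    proof (rule measure_countable_Union_approachable[of "?I ` C" \<delta> "b - a"])
      show "countable (?I ` C)" using C by auto
      show "0 < \<delta>" by fact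
      show "d \<in> lmeasurable" if "d \<in> ?I ` C" for d using that by auto
      show "measure lebesgue (\<Union>D') \<le> b - a" if "D' \<subseteq> ?I ` C" "finite D'" for D'
      proof -
        have "measure lebesgue (\<Union>D') \<le> measure lebesgue (\<Union>i\<in>C. ?I i)"
          by (rule measure_mono_fmeasurable) (use that Um in \<open>auto intro!: sets.finite_Union\<close>)
        then show ?thesis using full by simp
      qed
    qed (use full that in simp)
    then obtain F where F: "F \<subseteq> C" "finite F" "D = ?I ` F"
      by (meson finite_subset_image)
    have FK: "a \<le> fst i \<and> fst i < snd i \<and> snd i \<le> b" if "i \<in> F" for i
      using that F C by (auto simp: K_def)
    have Fdisj: "pairwise (\<lambda>i j. disjnt (?I i) (?I j)) F"
      using disj F by (blast intro: pairwise_subset)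
    have "measure lebesgue (\<Union>D) \<le> (\<Sum>i\<in>F. measure lebesgue (?I i))"
      unfolding F by (rule measure_UNION_le) (use F in auto)
    also have "\<dots> = (\<Sum>i\<in>F. snd i - fst i)"
      by (rule sum.cong) (use FK in \<open>auto dest: less_imp_le\<close>)
    finally have long: "b - a - \<delta> < (\<Sum>i\<in>F. snd i - fst i)" using D by simp
    obtain n :: nat and p q where
      pq: "\<forall>i<n. a \<le> p i \<and> p i \<le> q i \<and> q i \<le> b"
      and dis: "disjoint_family_on (\<lambda>i. {p i<..<q i}) {..<n}"
      and len: "(\<Sum>i<n. q i - p i) = (b - a) - (\<Sum>i\<in>F. snd i - fst i)"
      and inc: "\<bar>h b - h a\<bar> \<le> (\<Sum>i\<in>F. \<bar>h (snd i) - h (fst i)\<bar>) + (\<Sum>i<n. \<bar>h (q i) - h (p i)\<bar>)"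
      using increment_le_intervals_plus_gaps[OF F(2) \<open>a \<le> b\<close> FK Fdisj, of h] by blast
    have "(\<Sum>i<n. \<bar>h (q i) - h (p i)\<bar>) < \<epsilon>"
      using \<delta> pq dis len long by simp
    moreover have "(\<Sum>i\<in>F. \<bar>h (snd i) - h (fst i)\<bar>) \<le> c * (b - a)"
    proof -
      have "0 \<le> (\<Sum>i<n. q i - p i)" using pq by (intro sum_nonneg) auto
      then have "(\<Sum>i\<in>F. snd i - fst i) \<le> b - a" using len by simp
      then have "c * (\<Sum>i\<in>F. snd i - fst i) \<le> c * (b - a)" using c by simp
      moreover have "(\<Sum>i\<in>F. \<bar>h (snd i) - h (fst i)\<bar>) \<le> (\<Sum>i\<in>F. c * (snd i - fst i))"
        using F C by (intro sum_mono) (auto simp: K_def)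
      ultimately show ?thesis by (simp add: sum_distrib_left)
    qed
    ultimately show ?thesis using inc by simp
  qed
  have "\<bar>h b - h a\<bar> \<le> 0"
  proof (rule field_le_epsilon)
    fix e :: real assume "0 < e"
    define c where "c = e / (2 * (b - a + 1))"
    have "0 < c" "c * (b - a) \<le> e / 2"
      using \<open>0 < e\<close> \<open>a \<le> b\<close> by (auto simp: c_def field_simps)
    then show "\<bar>h b - h a\<bar> \<le> 0 + e" using bound[of c "e / 2"] \<open>0 < e\<close> by simp
  qed
  then show ?thesis by simp
qed

section \<open>Weak derivatives of primitives\<close>

lemma test_function_deriv:
  assumes "\<phi> \<in> test_functions S"
  shows "(\<phi> has_real_derivative deriv \<phi> x) (at x)" and "isCont (deriv \<phi>) x"
proof -
  have *: "(deriv ^^ n) \<phi> field_differentiable (at x)" for n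
    using assms by (simp add: test_functions_def)
  show "(\<phi> has_real_derivative deriv \<phi> x) (at x)"
    using *[of 0] by (simp add: field_differentiable_derivI)
  show "isCont (deriv \<phi>) x"
    using *[of 1] by (simp add: field_differentiable_imp_continuous_at)
qed

lemma test_function_eq_0:
  assumes "\<phi> \<in> test_functions S" and "x \<notin> S"
  shows "\<phi> x = 0"
  using assms closure_subset[of "{x. \<phi> x \<noteq> 0}"] by (auto simp: test_functions_def)

lemma integral_deriv_test_function:
  assumes \<phi>: "\<phi> \<in> test_functions {0<..<1}" and "s \<le> 1"
  shows "(\<integral>t. indicator {s..1} t * deriv \<phi> t \<partial>lborel) = - \<phi> s"
proof -
  have "(\<integral>t. deriv \<phi> t * indicator {s..1} t \<partial>lborel) = \<phi> 1 - \<phi> s"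
    by (rule integral_FTC_Icc_real[OF \<open>s \<le> 1\<close>]) (use test_function_deriv[OF \<phi>] in auto)
  then show ?thesis using test_function_eq_0[OF \<phi>, of 1] by (simp add: mult.commute)
qed

text \<open>This is integration by parts against a test function, done by Fubini's theorem on the triangle
  \<open>s \<le> t\<close>: the integral of \<open>\<phi>'\<close> over \<open>[s, 1]\<close> is \<open>- \<phi> s\<close>, since \<open>\<phi>\<close> vanishes at \<open>1\<close>.\<close>

lemma primitive_has_weak_derivative:
  fixes g h :: "real \<Rightarrow> real"
  assumes g: "set_integrable lborel {0..1} g"
    and h: "\<And>t. t \<in> {0<..<1} \<Longrightarrow> h t = (LINT s:{0..t}|lborel. g s)"
  shows "has_weak_derivative_on h g {0<..<1}"
proof -
  \<comment> \<open>Cutting \<open>g\<close> off to \<open>[0, 1]\<close> makes it a measurable function on the line, and gives the primitive a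
    version \<open>H\<close> that is measurable and bounded on the line.\<close>
  define G where "G = (\<lambda>s. indicator {0..1} s * g s)"
  have G: "integrable lborel G" using g by (simp add: G_def set_integrable_def)
  then have [measurable]: "G \<in> borel_measurable borel" by simp
  define H where "H = (\<lambda>t. \<integral>s. indicator {..t} s * G s \<partial>lborel)"
  have Hm[measurable]: "H \<in> borel_measurable borel"
  proof -
    have "(\<lambda>t. \<integral>s. (if s \<le> t then G s else 0) \<partial>lborel) \<in> borel_measurable (borel :: real measure)"
      by (rule lborel.borel_measurable_lebesgue_integral) measurable
    moreover have "H = (\<lambda>t. \<integral>s. (if s \<le> t then G s else 0) \<partial>lborel)"
      unfolding H_def by (intro ext Bochner_Integration.integral_cong) auto
    ultimately show ?thesis by simp
  qed
  have Hb: "\<bar>H t\<bar> \<le> (\<integral>s. \<bar>G s\<bar> \<partial>lborel)" for t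
  proof -
    have "\<bar>H t\<bar> \<le> (\<integral>s. \<bar>indicator {..t} s * G s\<bar> \<partial>lborel)"
      unfolding H_def by (rule integral_abs_bound)
    also have "\<dots> \<le> (\<integral>s. \<bar>G s\<bar> \<partial>lborel)"
    proof (rule integral_mono)
      show "integrable lborel (\<lambda>s. \<bar>indicator {..t} s * G s\<bar>)"
        using integrable_mult_indicator[OF _ G, of "{..t}"] by simp
    qed (use G in \<open>auto simp: indicator_def\<close>)
    finally show ?thesis .
  qed
  have hH: "h t = H t" if "t \<in> {0<..<1}" for t
  proof -
    have "h t = (\<integral>s. indicator {..t} s * G s \<partial>lborel)"
      unfolding h[OF that] set_lebesgue_integral_def
      by (rule Bochner_Integration.integral_cong) (use that in \<open>auto simp: G_def indicator_def\<close>)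
    then show ?thesis by (simp add: H_def)
  qed
  show ?thesis
    unfolding has_weak_derivative_on_def
  proof (intro conjI ballI)
    show "locally_integrable_on h {0<..<1}"
      unfolding locally_integrable_on_def
    proof (intro allI impI)
      fix K :: "real set" assume K: "compact K \<and> K \<subseteq> {0<..<1}"
      then have [measurable]: "K \<in> sets borel" by (simp add: borel_compact)
      have "set_integrable lborel K H"
        unfolding set_integrable_def
      proof (rule integrableI_bounded_set_indicator[where B = "\<integral>s. \<bar>G s\<bar> \<partial>lborel"])
        show "emeasure lborel K < \<infinity>" using K by (intro emeasure_bounded_finite compact_imp_bounded) blast
        show "AE x in lborel. x \<in> K \<longrightarrow> norm (H x) \<le> (\<integral>s. \<bar>G s\<bar> \<partial>lborel)" using Hb by simp
      qed auto
      then have "set_integrable lebesgue K H"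
        unfolding set_integrable_def by (subst integrable_completion) auto
      moreover have "set_integrable lebesgue K h = set_integrable lebesgue K H"
        by (rule set_integrable_cong) (use K hH in auto)
      ultimately show "set_integrable lebesgue K h" by simp
    qed
    show "locally_integrable_on g {0<..<1}"
      unfolding locally_integrable_on_def
    proof (intro allI impI)
      fix K :: "real set" assume K: "compact K \<and> K \<subseteq> {0<..<1}"
      then have "set_integrable lborel K g"
        by (intro set_integrable_subset[OF g]) (auto simp: borel_compact)
      then show "set_integrable lebesgue K g"
        unfolding set_integrable_def by (subst integrable_completion) auto
    qed
    fix \<phi> assume \<phi>: "\<phi> \<in> test_functions {0<..<1}"
    define \<psi> where "\<psi> = (\<lambda>t. indicator {0..1} t * deriv \<phi> t)"
    have cont: "continuous_on UNIV (deriv \<phi>)" "continuous_on UNIV \<phi>"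
      using test_function_deriv[OF \<phi>] by (auto simp: continuous_on_eq_continuous_at intro: DERIV_isCont)
    have [measurable]: "deriv \<phi> \<in> borel_measurable borel" "\<phi> \<in> borel_measurable borel"
      using cont by (auto intro: borel_measurable_continuous_onI)
    have \<psi>: "integrable lborel \<psi>"
      using borel_integrable_atLeastAtMost'[of 0 1 "deriv \<phi>"] continuous_on_subset[OF cont(1)]
      by (auto simp: \<psi>_def set_integrable_def)
    have [measurable]: "\<psi> \<in> borel_measurable borel" using \<psi> by simp
    define k where "k = (\<lambda>s t. if s \<le> t then G s * \<psi> t else 0)"
    have k: "integrable (lborel \<Otimes>\<^sub>M lborel) (case_prod k)"
    proof (rule Bochner_Integration.integrable_bound)
      show "integrable (lborel \<Otimes>\<^sub>M lborel) (\<lambda>(s, t). G s * \<psi> t)"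
        by (rule lborel_pair.Fubini_integrable) (use G \<psi> in \<open>auto simp: abs_mult\<close>)
    qed (auto simp: k_def indicator_def split_beta)
    have "(LINT t:{0<..<1}|lebesgue. h t * deriv \<phi> t) = (LINT t:{0<..<1}|lebesgue. H t * deriv \<phi> t)"
      by (rule set_lebesgue_integral_cong) (use hH in auto)
    also have "\<dots> = (LINT t:{0<..<1}|lborel. H t * deriv \<phi> t)"
      unfolding set_lebesgue_integral_def by (subst integral_completion) auto
    also have "\<dots> = (\<integral>t. (\<integral>s. k s t \<partial>lborel) \<partial>lborel)"
    proof -
      have "(\<integral>s. k s t \<partial>lborel) = H t * \<psi> t" for t
      proof -
        have "(\<integral>s. k s t \<partial>lborel) = (\<integral>s. (indicator {..t} s * G s) * \<psi> t \<partial>lborel)"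
          by (rule Bochner_Integration.integral_cong) (auto simp: k_def indicator_def)
        then show ?thesis by (simp add: H_def)
      qed
      moreover have "(LINT t:{0<..<1}|lborel. H t * deriv \<phi> t) = (\<integral>t. H t * \<psi> t \<partial>lborel)"
        unfolding set_lebesgue_integral_def
      proof (rule integral_cong_AE)
        show "AE t in lborel. indicator {0<..<1} t *\<^sub>R (H t * deriv \<phi> t) = H t * \<psi> t"
          using AE_lborel_singleton[of 0] AE_lborel_singleton[of 1]
          by eventually_elim (auto simp: \<psi>_def indicator_def)
      qed auto
      ultimately show ?thesis by simp
    qed
    also have "\<dots> = (\<integral>s. (\<integral>t. k s t \<partial>lborel) \<partial>lborel)"
      by (rule lborel_pair.Fubini_integral[OF k])
    also have "\<dots> = (\<integral>s. - (indicator {0<..<1} s * (g s * \<phi> s)) \<partial>lborel)"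
    proof (rule Bochner_Integration.integral_cong)
      fix s :: real
      show "(\<integral>t. k s t \<partial>lborel) = - (indicator {0<..<1} s * (g s * \<phi> s))"
      proof (cases "s \<in> {0..1}")
        case True
        have "(\<integral>t. k s t \<partial>lborel) = (\<integral>t. g s * (indicator {s..1} t * deriv \<phi> t) \<partial>lborel)"
          by (rule Bochner_Integration.integral_cong) (use True in \<open>auto simp: k_def \<psi>_def G_def indicator_def\<close>)
        also have "\<dots> = g s * - \<phi> s"
          using integral_deriv_test_function[OF \<phi>, of s] True by simp
        finally show ?thesis
          using test_function_eq_0[OF \<phi>, of s] by (auto simp: indicator_def)
        next
        case False
        then have "k s t = 0" for t by (auto simp: k_def G_def)
        with False show ?thesis by (auto simp: indicator_def)
      qed
    qed simp
    also have "\<dots> = - (\<integral>s. indicator {0<..<1} s * (G s * \<phi> s) \<partial>lborel)"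
      by (subst integral_minus, rule arg_cong[where f = uminus], rule Bochner_Integration.integral_cong)
        (auto simp: G_def indicator_def)
    also have "(\<integral>s. indicator {0<..<1} s * (G s * \<phi> s) \<partial>lborel) = (\<integral>s. indicator {0<..<1} s * (G s * \<phi> s) \<partial>lebesgue)"
      by (rule integral_completion[symmetric]) measurable
    also have "\<dots> = (LINT s:{0<..<1}|lebesgue. g s * \<phi> s)"
      unfolding set_lebesgue_integral_def
      by (rule Bochner_Integration.integral_cong) (auto simp: G_def indicator_def)
    finally show "(LINT t:{0<..<1}|lebesgue. h t * deriv \<phi> t) = - (LINT s:{0<..<1}|lebesgue. g s * \<phi> s)" .
  qed
qed

section \<open>The scale function as a homeomorphism\<close>

text \<open>The standing hypotheses on the measure, with non-atomicity in the form in which it is used. In this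
  setting \<open>U\<close> is a homeomorphism of \<open>[0, 1]\<close> with inverse \<open>V\<close>.\<close>

locale scale_measure = prob_space \<Lambda> for \<Lambda> :: "real measure" +
  assumes sets_eq: "sets \<Lambda> = sets (restrict_space borel {0..1})"
    and prob_singleton: "prob {x} = 0"
    and full_support: "full_support_on {0..1} \<Lambda>"
begin

abbreviation U :: "real \<Rightarrow> real" where "U \<equiv> scale_fun \<Lambda>"
abbreviation V :: "real \<Rightarrow> real" where "V \<equiv> scale_inv \<Lambda>"

lemma space_eq: "space \<Lambda> = {0..1}"
  using sets_eq_imp_space_eq[OF sets_eq] by (simp add: space_restrict_space)

lemma sets_iff: "A \<in> sets \<Lambda> \<longleftrightarrow> A \<in> sets borel \<and> A \<subseteq> {0..1}"
  unfolding sets_eq by (subst sets_restrict_space_iff) auto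

lemma scale_0: "U 0 = 0"
  by (simp add: scale_fun_def prob_singleton)

lemma scale_1: "U 1 = 1"
  using prob_space by (simp add: scale_fun_def space_eq)

lemma prob_Int_Ioc:
  assumes "A \<in> sets borel" "A \<subseteq> {0..1}" "x \<le> y"
  shows "prob (A \<inter> {x<..y}) = prob (A \<inter> {0..y}) - prob (A \<inter> {0..x})"
proof -
  have "A \<inter> {x<..y} = A \<inter> {0..y} - A \<inter> {0..x}" using assms by auto
  then show ?thesis
    using assms by (simp, subst finite_measure_Diff) (auto simp: sets_iff)
qed

lemma prob_Ioc:
  assumes "0 \<le> x" "x \<le> y" "y \<le> 1"
  shows "prob {x<..y} = U y - U x"
proof -
  have "{0..1} \<inter> {x<..y} = {x<..y}" "{0..1} \<inter> {0..y} = {0..y}" "{0..1} \<inter> {0..x} = {0..x}"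
    using assms by auto
  then show ?thesis using prob_Int_Ioc[of "{0..1}" x y] assms by (simp add: scale_fun_def)
qed

lemma prob_Icc:
  assumes "0 \<le> x" "x \<le> y" "y \<le> 1"
  shows "prob {x..y} = U y - U x"
proof -
  have "{x..y} = {x} \<union> {x<..y}" using assms by auto
  then have "prob {x..y} = prob {x} + prob {x<..y}"
    using assms by (simp only:, intro finite_measure_Union) (auto simp: sets_iff)
  then show ?thesis using prob_Ioc[OF assms] by (simp add: prob_singleton)
qed

lemma scale_strict_mono:
  assumes "0 \<le> x" "x < y" "y \<le> 1"
  shows "U x < U y"
proof -
  have "openin (top_of_set {0..1}) {x<..<y}"
    using assms by (intro open_subset) auto
  then have "0 < emeasure \<Lambda> {x<..<y}"
    using full_support dense[OF \<open>x < y\<close>] unfolding full_support_on_def by force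
  then have "0 < prob {x<..<y}" by (simp add: emeasure_eq_measure)
  also have "\<dots> \<le> prob {x<..y}"
    using assms by (intro finite_measure_mono) (auto simp: sets_iff)
  finally show ?thesis using prob_Ioc[of x y] assms by simp
qed

lemma scale_le_iff:
  assumes "x \<in> {0..1}" "y \<in> {0..1}"
  shows "U x \<le> U y \<longleftrightarrow> x \<le> y"
  using scale_strict_mono[of x y] scale_strict_mono[of y x] assms
  by (metis atLeastAtMost_iff less_le_not_le linorder_le_less_linear order_le_less)

lemma inj_on_scale: "inj_on U {0..1}"
  by (rule inj_onI) (metis scale_le_iff order_antisym order_refl)

text \<open>On \<open>[0, 1]\<close>, \<open>U\<close> is the distribution function of the extension of \<open>\<Lambda>\<close> by zero to the line, and
  distribution functions jump exactly at the atoms.\<close>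

lemma continuous_on_scale: "continuous_on {0..1} U"
proof -
  have id: "(\<lambda>x. x) \<in> measurable \<Lambda> borel"
    using measurable_restrict_space1[of "\<lambda>x::real. x" borel borel "{0..1}"]
    by (simp add: measurable_cong_sets[OF sets_eq refl])
  interpret R: real_distribution "distr \<Lambda> borel (\<lambda>x. x)" using id by simp
  have d: "measure (distr \<Lambda> borel (\<lambda>x. x)) A = prob (A \<inter> {0..1})" if "A \<in> sets borel" for A
    using measure_distr[OF id that] by (simp add: space_eq)
  have "measure (distr \<Lambda> borel (\<lambda>x. x)) {x} = 0" for x
    using d[of "{x}"] by (cases "x \<in> {0..1}") (auto simp: prob_singleton)
  then have "continuous_on {0..1} (cdf (distr \<Lambda> borel (\<lambda>x. x)))"
    using R.isCont_cdf by (auto intro!: continuous_at_imp_continuous_on)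
  moreover have "cdf (distr \<Lambda> borel (\<lambda>x. x)) x = U x" if "x \<in> {0..1}" for x
  proof -
    have "{..x} \<inter> {0..1} = {0..x}" using that by auto
    then show ?thesis using d[of "{..x}"] by (simp only: cdf_def scale_fun_def) simp
  qed
  ultimately show ?thesis by (rule continuous_on_eq)
qed

lemma scale_image: "U ` {0..1} = {0..1}"
proof
  show "U ` {0..1} \<subseteq> {0..1}"
    using scale_le_iff[of 0] scale_le_iff[of _ 1] by (auto simp: scale_0 scale_1)
  show "{0..1} \<subseteq> U ` {0..1}"
    using IVT'[of U 0 _ 1] continuous_on_scale by (force simp: scale_0 scale_1)
qed

lemma scale_in: "x \<in> {0..1} \<Longrightarrow> U x \<in> {0..1}"
  using scale_image by blast

lemma scale_inv_in: "t \<in> {0..1} \<Longrightarrow> V t \<in> {0..1}"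
  unfolding scale_inv_def by (rule inv_into_into) (simp add: scale_image)

lemma scale_scale_inv: "t \<in> {0..1} \<Longrightarrow> U (V t) = t"
  unfolding scale_inv_def by (rule f_inv_into_f) (simp add: scale_image)

lemma scale_inv_scale: "x \<in> {0..1} \<Longrightarrow> V (U x) = x"
  unfolding scale_inv_def by (rule inv_into_f_f[OF inj_on_scale])

lemma scale_le_iff_le_scale_inv:
  assumes "x \<in> {0..1}" "t \<in> {0..1}"
  shows "U x \<le> t \<longleftrightarrow> x \<le> V t"
  using scale_le_iff[OF assms(1) scale_inv_in[OF assms(2)]] by (simp add: scale_scale_inv[OF assms(2)])

lemma measurable_scale: "U \<in> borel_measurable \<Lambda>"
  using borel_measurable_continuous_on_restrict[OF continuous_on_scale]
  by (simp add: measurable_cong_sets[OF sets_eq refl])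

text \<open>This is the probability integral transform: the mass of \<open>{x. U x \<le> t}\<close> is \<open>U (V t) = t\<close>, which is the
  distribution function of the uniform law.\<close>

lemma distr_scale: "distr \<Lambda> borel U = uniform_measure lborel {0..1}"
proof (rule cdf_unique)
  show "real_distribution (distr \<Lambda> borel U)" using measurable_scale by simp
  show "real_distribution (uniform_measure lborel {0..1::real})"
    by (auto simp: real_distribution_def real_distribution_axioms_def intro!: prob_space_uniform_measure)
  show "cdf (distr \<Lambda> borel U) = cdf (uniform_measure lborel {0..1})"
  proof
    fix t :: real
    have lhs: "cdf (distr \<Lambda> borel U) t = prob (U -` {..t} \<inter> {0..1})"
      by (simp add: cdf_def measure_distr[OF measurable_scale] space_eq)
    have rhs: "cdf (uniform_measure lborel {0..1}) t = measure lborel ({0..1} \<inter> {..t})"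
      by (simp add: cdf_def measure_uniform_measure)
    consider "t < 0" | "t \<in> {0..1}" | "1 < t" by fastforce
    then show "cdf (distr \<Lambda> borel U) t = cdf (uniform_measure lborel {0..1}) t"
    proof cases
      case 1
      then have "U -` {..t} \<inter> {0..1} = {}" "{0..1} \<inter> {..t} = {}" using scale_in by force+
      then show ?thesis unfolding lhs rhs by (metis measure_empty)
    next
      case 2
      have "U -` {..t} \<inter> {0..1} = {0..V t}"
        using scale_inv_in[OF 2] scale_le_iff_le_scale_inv[OF _ 2] by force
      moreover have "{0..1} \<inter> {..t} = {0..t}" using 2 by auto
      ultimately show ?thesis unfolding lhs rhs
        using 2 scale_scale_inv[OF 2] by (simp add: scale_fun_def)
    next
      case 3
      then have "U -` {..t} \<inter> {0..1} = {0..1}" using scale_in by force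
      moreover have "{0..1} \<inter> {..t} = {0..1}" using 3 by auto
      ultimately show ?thesis unfolding lhs rhs
        using scale_1 by (simp add: scale_fun_def)
    qed
  qed
qed

text \<open>In the scale of \<open>U\<close> the measure \<open>\<Lambda>\<close> becomes Lebesgue measure; this transports null sets and
  sets of positive measure between the two sides.\<close>

lemma emeasure_scale_image:
  assumes A: "A \<subseteq> {0..1}" and UA: "U ` A \<in> sets borel"
  shows "emeasure lborel (U ` A) = emeasure \<Lambda> A"
proof -
  have sub: "U ` A \<subseteq> {0..1}" using A scale_image by blast
  have "U -` (U ` A) \<inter> {0..1} = A" using A inj_on_scale by (auto dest: inj_onD)
  then have "emeasure \<Lambda> A = emeasure (distr \<Lambda> borel U) (U ` A)"
    by (simp add: emeasure_distr[OF measurable_scale UA] space_eq)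
  also have "\<dots> = emeasure lborel (U ` A)"
    unfolding distr_scale using UA sub by (subst emeasure_uniform_measure) (auto simp: Int_absorb1 divide_ennreal_def)
  finally show ?thesis by simp
qed

section \<open>Hoelder points of the scale function\<close>

text \<open>The points at which the scale function is \<open>\<alpha>\<close>-Hoelder with constant \<open>C\<close>, at all distances. Bounding
  increments of \<open>U\<close> instead of masses of balls makes this an intersection of closed conditions.\<close>

definition scale_holder_points :: "real \<Rightarrow> real \<Rightarrow> real set" where
  "scale_holder_points \<alpha> C = {x\<in>{0..1}. \<forall>y\<in>{0..1}. \<bar>U y - U x\<bar> \<le> C * \<bar>y - x\<bar> powr \<alpha>}"

lemma scale_holder_points_subset: "scale_holder_points \<alpha> C \<subseteq> {0..1}"
  by (auto simp: scale_holder_points_def)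

lemma compact_scale_holder_points:
  assumes "0 < \<alpha>"
  shows "compact (scale_holder_points \<alpha> C)"
proof -
  have "closed ({0..1} \<inter> (\<lambda>x. C * \<bar>y - x\<bar> powr \<alpha> - \<bar>U y - U x\<bar>) -` {0..})" for y
    by (rule continuous_closed_preimage)
      (use assms in \<open>auto intro!: continuous_intros continuous_on_powr' continuous_on_scale\<close>)
  then have "closed ({0..1} \<inter> (\<Inter>y\<in>{0..1}. {0..1} \<inter> (\<lambda>x. C * \<bar>y - x\<bar> powr \<alpha> - \<bar>U y - U x\<bar>) -` {0..}))"
    by (intro closed_Int closed_INT) auto
  also have "({0..1} \<inter> (\<Inter>y\<in>{0..1}. {0..1} \<inter> (\<lambda>x. C * \<bar>y - x\<bar> powr \<alpha> - \<bar>U y - U x\<bar>) -` {0..}))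
      = scale_holder_points \<alpha> C"
    unfolding scale_holder_points_def by auto
  finally have "closed (scale_holder_points \<alpha> C)" .
  then show ?thesis
    using compact_Int_closed[of "{0..1}" "scale_holder_points \<alpha> C"] scale_holder_points_subset
    by (simp add: Int_absorb1)
qed

lemma compact_scale_image:
  assumes "0 < \<alpha>"
  shows "compact (U ` scale_holder_points \<alpha> C)"
  using continuous_on_subset[OF continuous_on_scale scale_holder_points_subset]
    compact_scale_holder_points[OF assms] by (rule compact_continuous_image)

lemma scale_holder_points_sets:
  "0 < \<alpha> \<Longrightarrow> scale_holder_points \<alpha> C \<in> sets \<Lambda>"
  using compact_scale_holder_points scale_holder_points_subset by (auto simp: sets_iff borel_compact)

lemma scale_diff_le_prob_ball:
  assumes "x \<in> {0..1}" "y \<in> {0..1}" "\<bar>y - x\<bar> < r"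
  shows "\<bar>U y - U x\<bar> \<le> prob {z\<in>{0..1}. \<bar>x - z\<bar> < r}"
proof -
  have "\<bar>U y - U x\<bar> = prob {min x y..max x y}"
    using prob_Icc[of x y] prob_Icc[of y x] scale_le_iff[of x y] scale_le_iff[of y x] assms
    by (auto simp: min_def max_def)
  also have "\<dots> \<le> prob {z\<in>{0..1}. \<bar>x - z\<bar> < r}"
    by (rule finite_measure_mono) (use assms in \<open>auto simp: sets_iff\<close>)
  finally show ?thesis .
qed

text \<open>A ball in \<open>[0, 1]\<close> lies in the interval between the points at distance \<open>r\<close> from its centre, cut off
  at \<open>0\<close> and \<open>1\<close>.\<close>

lemma prob_ball_le:
  assumes "x \<in> {0..1}" "0 < r"
  shows "\<exists>y\<in>{0..1}. \<exists>z\<in>{0..1}. \<bar>y - x\<bar> \<le> r \<and> \<bar>z - x\<bar> \<le> r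
           \<and> prob {z\<in>{0..1}. \<bar>x - z\<bar> < r} \<le> \<bar>U y - U x\<bar> + \<bar>U z - U x\<bar>"
proof -
  let ?y = "max 0 (x - r)" and ?z = "min 1 (x + r)"
  have yz: "?y \<in> {0..1}" "?z \<in> {0..1}" "\<bar>?y - x\<bar> \<le> r" "\<bar>?z - x\<bar> \<le> r" using assms by auto
  have "prob {z\<in>{0..1}. \<bar>x - z\<bar> < r} \<le> prob {?y..?z}"
    by (rule finite_measure_mono) (use assms in \<open>auto simp: sets_iff\<close>)
  also have "\<dots> = U ?z - U ?y" by (rule prob_Icc) (use assms in auto)
  finally have "prob {z\<in>{0..1}. \<bar>x - z\<bar> < r} \<le> \<bar>U ?y - U x\<bar> + \<bar>U ?z - U x\<bar>" by linarith
  with yz show ?thesis by blast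
qed

text \<open>The mass of a ball around \<open>x\<close> and the increments of \<open>U\<close> from \<open>x\<close> bound each other up to
  constant factors and a doubling of the radius. The limit superior sees only small radii, while a Hoelder point satisfies its bound at all
  distances; this costs only a larger constant, because increments of \<open>U\<close> are at most \<open>1\<close>.\<close>

lemma limsup_finite_iff_scale_holder_point:
  assumes x: "x \<in> {0..1}" and \<alpha>: "0 < \<alpha>"
  shows "Limsup (at_right 0) (\<lambda>r. emeasure \<Lambda> {y\<in>{0..1}. \<bar>x - y\<bar> < r} / ennreal (r powr \<alpha>)) < \<infinity>
         \<longleftrightarrow> (\<exists>n::nat. x \<in> scale_holder_points \<alpha> (real n))" (is "Limsup _ ?q < _ \<longleftrightarrow> _")
proof
  have q: "?q r = ennreal (prob {y\<in>{0..1}. \<bar>x - y\<bar> < r} / r powr \<alpha>)" if "0 < r" for r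
    using that by (simp add: emeasure_eq_measure divide_ennreal)
  {
    assume "Limsup (at_right 0) ?q < \<infinity>"
    then obtain c where c: "0 \<le> c" "Limsup (at_right 0) ?q = ennreal c"
      by (cases "Limsup (at_right 0) ?q") auto
    have "Limsup (at_right 0) ?q < ennreal (c + 1)"
      unfolding c(2) using c(1) by (simp add: ennreal_less_iff)
    then have "eventually (\<lambda>r. ?q r < ennreal (c + 1)) (at_right 0)"
      by (rule Limsup_lessD)
    then obtain R where R: "0 < R" "\<And>r. 0 < r \<Longrightarrow> r < R \<Longrightarrow> ?q r < ennreal (c + 1)"
      unfolding eventually_at_right_field by blast
    have ball: "prob {y\<in>{0..1}. \<bar>x - y\<bar> < r} \<le> (c + 1) * r powr \<alpha>" if "0 < r" "r < R" for r
    proof -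
      have "prob {y\<in>{0..1}. \<bar>x - y\<bar> < r} / r powr \<alpha> < c + 1"
        using R(2)[OF that] unfolding q[OF that(1)] by (subst (asm) ennreal_less_iff) auto
      then show ?thesis using that by (simp add: field_simps)
    qed
    \<comment> \<open>The first summand serves distances below \<open>R / 2\<close>, the second one all larger distances.\<close>
    define C where "C = (c + 1) * 2 powr \<alpha> + (2 / R) powr \<alpha>"
    have "\<bar>U y - U x\<bar> \<le> C * \<bar>y - x\<bar> powr \<alpha>" if y: "y \<in> {0..1}" for y
    proof -
      consider "y = x" | "0 < \<bar>y - x\<bar>" "2 * \<bar>y - x\<bar> < R" | "R \<le> 2 * \<bar>y - x\<bar>" by linarith
      then show ?thesis
      proof cases
        case 2
        have "\<bar>U y - U x\<bar> \<le> prob {z\<in>{0..1}. \<bar>x - z\<bar> < 2 * \<bar>y - x\<bar>}"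
          using 2 by (intro scale_diff_le_prob_ball x y) auto
        also have "\<dots> \<le> (c + 1) * (2 * \<bar>y - x\<bar>) powr \<alpha>" using 2 by (intro ball) auto
        also have "\<dots> = (c + 1) * 2 powr \<alpha> * \<bar>y - x\<bar> powr \<alpha>" by (simp add: powr_mult)
        also have "\<dots> \<le> C * \<bar>y - x\<bar> powr \<alpha>" unfolding C_def by (intro mult_right_mono) auto
        finally show ?thesis .
      next
        case 3
        have "\<bar>U y - U x\<bar> \<le> 1" using scale_in[OF x] scale_in[OF y] by auto
        also have "1 \<le> (2 / R * \<bar>y - x\<bar>) powr \<alpha>"
          using 3 R(1) \<alpha> by (intro ge_one_powr_ge_zero) (auto simp: field_simps)
        also have "\<dots> = (2 / R) powr \<alpha> * \<bar>y - x\<bar> powr \<alpha>" using R(1) by (intro powr_mult)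
        also have "\<dots> \<le> C * \<bar>y - x\<bar> powr \<alpha>" unfolding C_def using c(1) by (intro mult_right_mono) auto
        finally show ?thesis .
      qed simp
    qed
    moreover have "C * \<bar>y - x\<bar> powr \<alpha> \<le> real (nat \<lceil>C\<rceil>) * \<bar>y - x\<bar> powr \<alpha>" for y
      by (intro mult_right_mono real_nat_ceiling_ge) simp
    ultimately have "x \<in> scale_holder_points \<alpha> (real (nat \<lceil>C\<rceil>))"
      using x order_trans unfolding scale_holder_points_def by blast
    then show "\<exists>n::nat. x \<in> scale_holder_points \<alpha> (real n)" by blast
  }
  assume "\<exists>n::nat. x \<in> scale_holder_points \<alpha> (real n)"
  then obtain n :: nat where n: "x \<in> scale_holder_points \<alpha> (real n)" by blast
  have "?q r \<le> ennreal (2 * real n)" if r: "0 < r" for r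
  proof -
    obtain y z where yz: "y \<in> {0..1}" "z \<in> {0..1}" "\<bar>y - x\<bar> \<le> r" "\<bar>z - x\<bar> \<le> r"
      and p: "prob {z\<in>{0..1}. \<bar>x - z\<bar> < r} \<le> \<bar>U y - U x\<bar> + \<bar>U z - U x\<bar>"
      using prob_ball_le[OF x r] by blast
    have "\<bar>U w - U x\<bar> \<le> real n * r powr \<alpha>" if "w \<in> {0..1}" "\<bar>w - x\<bar> \<le> r" for w
    proof -
      have "\<bar>U w - U x\<bar> \<le> real n * \<bar>w - x\<bar> powr \<alpha>"
        using n that unfolding scale_holder_points_def by auto
      also have "\<dots> \<le> real n * r powr \<alpha>"
        using that \<alpha> by (intro mult_left_mono powr_mono2) auto
      finally show ?thesis .
    qed
    from this[of y] this[of z] yz p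
    have "prob {z\<in>{0..1}. \<bar>x - z\<bar> < r} \<le> 2 * real n * r powr \<alpha>" by auto
    then show ?thesis
      unfolding q[OF r] using r by (intro ennreal_leI) (simp add: field_simps)
  qed
  then have "eventually (\<lambda>r. ?q r \<le> ennreal (2 * real n)) (at_right 0)"
    unfolding eventually_at_right_field by (intro exI[of _ 1]) simp
  then have "Limsup (at_right 0) ?q \<le> ennreal (2 * real n)" by (rule Limsup_bounded)
  then show "Limsup (at_right 0) ?q < \<infinity>" by (rule order_le_less_trans) simp
qed

text \<open>The largest admissible \<open>E\<close> in the definition is the countable union of the compact sets of Hoelder
  points with constants \<open>0, 1, 2, \<dots>\<close>, and it has positive mass iff one of them has.\<close>

lemma generalized_frostman_iff:
  assumes \<alpha>: "0 < \<alpha>"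
  shows "generalized_frostman \<alpha> \<Lambda> \<longleftrightarrow> (\<exists>n::nat. 0 < emeasure \<Lambda> (scale_holder_points \<alpha> (real n)))"
proof
  assume "generalized_frostman \<alpha> \<Lambda>"
  then obtain E where E: "E \<in> sets borel" "E \<subseteq> {0..1}" "0 < emeasure \<Lambda> E"
    and "\<forall>x\<in>E. Limsup (at_right 0)
           (\<lambda>r. emeasure \<Lambda> {y\<in>{0..1}. \<bar>x - y\<bar> < r} / ennreal (r powr \<alpha>)) < \<infinity>"
    unfolding generalized_frostman_def by blast
  then have "E \<subseteq> (\<Union>n::nat. scale_holder_points \<alpha> (real n))"
    using limsup_finite_iff_scale_holder_point[OF _ \<alpha>] by blast
  then have "emeasure \<Lambda> E \<le> emeasure \<Lambda> (\<Union>n::nat. scale_holder_points \<alpha> (real n))"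
    by (rule emeasure_mono) (use scale_holder_points_sets[OF \<alpha>] in auto)
  then have "emeasure \<Lambda> (\<Union>n::nat. scale_holder_points \<alpha> (real n)) \<noteq> 0" using E(3) by auto
  then show "\<exists>n::nat. 0 < emeasure \<Lambda> (scale_holder_points \<alpha> (real n))"
    using emeasure_UN_eq_0[of \<Lambda> "\<lambda>n. scale_holder_points \<alpha> (real n)"] scale_holder_points_sets[OF \<alpha>]
    by (force simp: zero_less_iff_neq_zero)
next
  assume "\<exists>n::nat. 0 < emeasure \<Lambda> (scale_holder_points \<alpha> (real n))"
  then obtain n :: nat where n: "0 < emeasure \<Lambda> (scale_holder_points \<alpha> (real n))" by blast
  show "generalized_frostman \<alpha> \<Lambda>"
    unfolding generalized_frostman_def
  proof (intro bexI[of _ "scale_holder_points \<alpha> (real n)"] conjI ballI n scale_holder_points_subset)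
    fix x assume "x \<in> scale_holder_points \<alpha> (real n)"
    then show "Limsup (at_right 0)
           (\<lambda>r. emeasure \<Lambda> {y\<in>{0..1}. \<bar>x - y\<bar> < r} / ennreal (r powr \<alpha>)) < \<infinity>"
      using limsup_finite_iff_scale_holder_point[OF _ \<alpha>] scale_holder_points_subset by blast
  qed (use compact_scale_holder_points[OF \<alpha>] in \<open>auto simp: borel_compact\<close>)
qed

section \<open>Hoelder functions of finite energy\<close>

text \<open>The witness is \<open>f x = \<Lambda> (P \<inter> [0, x])\<close>, the distribution function of \<open>\<Lambda>\<close> restricted to a set \<open>P\<close> of
  Hoelder points of positive mass. In the scale of \<open>U\<close> it is the primitive of the indicator of
  \<open>U ` P\<close>, hence of finite energy. It increases only on intervals that meet \<open>P\<close>, and there the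
  increments of \<open>U\<close> are controlled from a point of \<open>P\<close>.\<close>

lemma ex_nonconstant_holder_if_frostman:
  assumes \<alpha>: "0 < \<alpha>" and pos: "0 < emeasure \<Lambda> (scale_holder_points \<alpha> C)"
  shows "\<exists>f\<in>form_domain \<Lambda>. \<not> f constant_on {0..1} \<and> holder_continuous \<alpha> f"
proof -
  define P where "P = scale_holder_points \<alpha> C"
  define Q where "Q = U ` P"
  define f where "f = (\<lambda>x. prob (P \<inter> {0..x}))"
  have P: "P \<in> sets borel" "P \<subseteq> {0..1}"
    using compact_scale_holder_points[OF \<alpha>] scale_holder_points_subset by (auto simp: P_def borel_compact)
  have Q[measurable]: "Q \<in> sets borel"
    unfolding Q_def P_def by (rule borel_compact[OF compact_scale_image[OF \<alpha>]])
  have f_diff: "\<bar>f y - f x\<bar> = prob (P \<inter> {x<..y})" if "x \<le> y" for x y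
    using prob_Int_Ioc[OF P that] measure_nonneg[of \<Lambda> "P \<inter> {x<..y}"] by (simp add: f_def)
  have f_le: "\<bar>f y - f x\<bar> \<le> \<bar>U y - U x\<bar>" if "x \<in> {0..1}" "y \<in> {0..1}" for x y
  proof -
    have "\<bar>f y - f x\<bar> \<le> \<bar>U y - U x\<bar>" if "x \<le> y" "0 \<le> x" "y \<le> 1" for x y
    proof -
      have "prob (P \<inter> {x<..y}) \<le> prob {x<..y}"
        using that by (intro finite_measure_mono) (auto simp: sets_iff)
      then show ?thesis using f_diff[OF that(1)] prob_Ioc[of x y] that by simp
    qed
    from this[of x y] this[of y x] that show ?thesis
      by (cases "x \<le> y") (auto simp: abs_minus_commute)
  qed
  have f_inv: "(f \<circ> V) t = (LINT s:{0..t}|lborel. indicator Q s)" if t: "t \<in> {0..1}" for t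
  proof -
    have "U ` (P \<inter> {0..V t}) = Q \<inter> {0..t}"
    proof -
      have "P \<inter> {0..V t} = {x \<in> P. U x \<le> t}"
        using P(2) scale_le_iff_le_scale_inv[OF _ t] by auto
      moreover have "Q \<inter> {0..t} = U ` {x \<in> P. U x \<le> t}"
        using P(2) scale_in unfolding Q_def by auto
      ultimately show ?thesis by simp
    qed
    then have "emeasure lborel (Q \<inter> {0..t}) = emeasure \<Lambda> (P \<inter> {0..V t})"
      using emeasure_scale_image[of "P \<inter> {0..V t}"] P(2) by auto
    then have "(f \<circ> V) t = measure lborel (Q \<inter> {0..t})"
      by (simp add: f_def measure_def)
    also have "\<dots> = (LINT s:{0..t}|lborel. indicator Q s)"
      unfolding set_lebesgue_integral_def by (simp add: indicator_inter_arith[symmetric] Int_commute)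
    finally show ?thesis .
  qed
  have "f \<in> form_domain \<Lambda>"
    unfolding form_domain_def
  proof (intro CollectI conjI exI)
    show "continuous_on {0..1} f"
      unfolding continuous_on_iff
    proof (intro ballI allI impI)
      fix x e :: real assume x: "x \<in> {0..1}" and "0 < e"
      then obtain d where "0 < d" "\<And>y. y \<in> {0..1} \<Longrightarrow> dist y x < d \<Longrightarrow> dist (U y) (U x) < e"
        using continuous_on_scale unfolding continuous_on_iff by blast
      then show "\<exists>d>0. \<forall>y\<in>{0..1}. dist y x < d \<longrightarrow> dist (f y) (f x) < e"
        using f_le[OF x] by (metis dist_real_def order_le_less_trans)
    qed
    show "absolutely_continuous_fun 0 1 (f \<circ> V)"
    proof (rule lipschitz_imp_absolutely_continuous_fun)
      fix s t :: real assume st: "s \<in> {0..1}" "t \<in> {0..1}"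
      show "\<bar>(f \<circ> V) t - (f \<circ> V) s\<bar> \<le> \<bar>t - s\<bar>"
        using f_le[OF st[THEN scale_inv_in]] by (simp add: scale_scale_inv st del: atLeastAtMost_iff)
    qed
    show "has_weak_derivative_on (f \<circ> V) (indicator Q) {0<..<1}"
    proof (rule primitive_has_weak_derivative)
      show "set_integrable lborel {0..1} (indicator Q :: real \<Rightarrow> real)"
        unfolding set_integrable_def
        by (rule integrableI_bounded_set_indicator[where B = 1]) (auto simp: indicator_def)
    qed (use f_inv in auto)
    show "square_integrable (lebesgue_on {0..1}) (indicator Q :: real \<Rightarrow> real)"
      unfolding square_integrable_def
    proof
      show Qm: "(indicator Q :: real \<Rightarrow> real) \<in> borel_measurable (lebesgue_on {0..1})"
        using Q by (intro measurable_restrict_space1 borel_measurable_indicator) simp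
      have "finite_measure (lebesgue_on {0..1::real})"
        by (rule finite_measure_lebesgue_on) simp
      then show "integrable (lebesgue_on {0..1}) (\<lambda>x. (indicator Q x :: real)\<^sup>2)"
        by (rule finite_measure.integrable_const_bound[where B = 1])
          (simp add: indicator_def, intro borel_measurable_power Qm)
    qed
  qed
  moreover have "\<not> f constant_on {0..1}"
  proof
    assume "f constant_on {0..1}"
    then have "f 1 = f 0" unfolding constant_on_def by auto
    moreover have "P \<inter> {0..1} = P" using P(2) by auto
    moreover have "f 0 \<le> prob {0}" unfolding f_def
      by (intro finite_measure_mono) (auto simp: sets_iff)
    ultimately have "prob P \<le> 0" by (simp add: f_def prob_singleton)
    then show False using pos by (simp add: emeasure_eq_measure P_def)
  qed
  moreover have "holder_continuous \<alpha> f"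
    unfolding holder_continuous_def
  proof (intro exI conjI ballI)
    show "0 < 2 * \<bar>C\<bar> + 1" by simp
    have *: "\<bar>f y - f x\<bar> \<le> (2 * \<bar>C\<bar> + 1) * \<bar>y - x\<bar> powr \<alpha>" if xy: "x \<le> y" "0 \<le> x" "y \<le> 1" for x y
    proof (cases "P \<inter> {x<..y} = {}")
      case False
      then obtain z where z: "z \<in> P" "x < z" "z \<le> y" by auto
      have zb: "\<bar>U w - U z\<bar> \<le> \<bar>C\<bar> * \<bar>y - x\<bar> powr \<alpha>" if "w \<in> {x, y}" for w
      proof -
        have "\<bar>U w - U z\<bar> \<le> C * \<bar>w - z\<bar> powr \<alpha>"
          using z(1) that xy unfolding P_def scale_holder_points_def by auto
        also have "\<dots> \<le> \<bar>C\<bar> * \<bar>w - z\<bar> powr \<alpha>" by (intro mult_right_mono) auto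
        also have "\<dots> \<le> \<bar>C\<bar> * \<bar>y - x\<bar> powr \<alpha>"
          using that z \<alpha> by (intro mult_left_mono powr_mono2) auto
        finally show ?thesis .
      qed
      have "\<bar>f y - f x\<bar> \<le> \<bar>U y - U x\<bar>" using xy by (intro f_le) auto
      also have "\<dots> \<le> 2 * \<bar>C\<bar> * \<bar>y - x\<bar> powr \<alpha>" using zb[of x] zb[of y] by auto
      also have "\<dots> \<le> (2 * \<bar>C\<bar> + 1) * \<bar>y - x\<bar> powr \<alpha>" by (intro mult_right_mono) auto
      finally show ?thesis .
    qed (use f_diff[OF xy(1)] in simp)
    fix x y :: real assume "x \<in> {0..1}" "y \<in> {0..1}"
    then show "\<bar>f x - f y\<bar> \<le> (2 * \<bar>C\<bar> + 1) * \<bar>x - y\<bar> powr \<alpha>"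
      using *[of x y] *[of y x] by (cases "x \<le> y") (auto simp: abs_minus_commute)
  qed
  ultimately show ?thesis by blast
qed

text \<open>Suppose that the Hoelder points of \<open>U\<close> are a null set. At any other point \<open>x\<close> there are \<open>y\<close>
  arbitrarily close to \<open>x\<close> for which \<open>|y - x| powr \<alpha>\<close>, and thus \<open>|f y - f x|\<close>, is a tiny fraction of
  \<open>|U y - U x|\<close>. So \<open>f \<circ> V\<close> has flat short secants at almost every point, and being
  absolutely continuous it is constant.\<close>

lemma frostman_if_ex_nonconstant_holder:
  assumes \<alpha>: "0 < \<alpha>" and f: "f \<in> form_domain \<Lambda>" "\<not> f constant_on {0..1}"
    and holder: "holder_continuous \<alpha> f"
  shows "generalized_frostman \<alpha> \<Lambda>"
proof (rule ccontr)
  assume "\<not> generalized_frostman \<alpha> \<Lambda>"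
  then have null: "emeasure \<Lambda> (scale_holder_points \<alpha> (real n)) = 0" for n :: nat
    using generalized_frostman_iff[OF \<alpha>] by (simp add: zero_less_iff_neq_zero)
  obtain K where K: "0 < K" "\<And>x y. x \<in> {0..1} \<Longrightarrow> y \<in> {0..1} \<Longrightarrow> \<bar>f x - f y\<bar> \<le> K * \<bar>x - y\<bar> powr \<alpha>"
    using holder unfolding holder_continuous_def by blast
  define N where "N = (\<Union>n::nat. U ` scale_holder_points \<alpha> (real n))"
  have N: "negligible N"
    unfolding N_def
  proof (rule negligible_countable_Union)
    fix S assume "S \<in> range (\<lambda>n::nat. U ` scale_holder_points \<alpha> (real n))"
    then obtain n :: nat where S: "S = U ` scale_holder_points \<alpha> (real n)" by blast
    have "S \<in> sets borel" unfolding S by (rule borel_compact[OF compact_scale_image[OF \<alpha>]])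
    moreover have "emeasure lborel S = 0"
      using emeasure_scale_image[OF scale_holder_points_subset] calculation null[of n] unfolding S by simp
    ultimately show "negligible S"
      by (simp add: negligible_iff_null_sets null_sets_def)
  qed auto
  have ac: "absolutely_continuous_fun 0 1 (f \<circ> V)" using f(1) by (simp add: form_domain_def)
  have flat: "\<exists>s. s \<noteq> t \<and> \<bar>s - t\<bar> < d \<and> \<bar>(f \<circ> V) s - (f \<circ> V) t\<bar> \<le> c * \<bar>s - t\<bar>"
    if t: "t \<in> {0..1} - N" and "0 < c" "0 < d" for t c d
  proof -
    let ?x = "V t"
    have x: "?x \<in> {0..1}" "U ?x = t" using t scale_inv_in scale_scale_inv by auto
    obtain e where e: "0 < e" "\<And>y. y \<in> {0..1} \<Longrightarrow> \<bar>y - ?x\<bar> < e \<Longrightarrow> \<bar>U y - t\<bar> < d"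
      using continuous_on_scale[unfolded continuous_on_iff dist_real_def, rule_format, OF x(1) \<open>0 < d\<close>] x(2)
      by auto
    \<comment> \<open>The first summand makes the secant flat, the second one forces \<open>y\<close> to be within \<open>e\<close> of \<open>V t\<close>.\<close>
    define n where "n = nat \<lceil>K / c + 1 / e powr \<alpha>\<rceil>"
    have n: "K / c + 1 / e powr \<alpha> \<le> real n" unfolding n_def by (rule real_nat_ceiling_ge)
    have "?x \<notin> scale_holder_points \<alpha> (real n)" using t x(2) by (force simp: N_def)
    then obtain y where y: "y \<in> {0..1}" "real n * \<bar>y - ?x\<bar> powr \<alpha> < \<bar>U y - t\<bar>"
      using x unfolding scale_holder_points_def by force
    have "0 < \<bar>U y - t\<bar>"
      by (rule le_less_trans[OF _ y(2)]) simp
    then have ne: "U y \<noteq> t" by simp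
    have "\<bar>y - ?x\<bar> < e"
    proof (rule ccontr)
      assume "\<not> \<bar>y - ?x\<bar> < e"
      then have "e powr \<alpha> \<le> \<bar>y - ?x\<bar> powr \<alpha>" using e(1) \<alpha> by (intro powr_mono2) auto
      moreover have "1 / e powr \<alpha> \<le> real n"
        using n K(1) \<open>0 < c\<close> by (meson add_increasing divide_nonneg_pos dual_order.trans less_imp_le order_refl)
      ultimately have "1 / e powr \<alpha> * e powr \<alpha> \<le> real n * \<bar>y - ?x\<bar> powr \<alpha>"
        by (intro mult_mono) auto
      then have "1 \<le> real n * \<bar>y - ?x\<bar> powr \<alpha>" using e(1) by simp
      moreover have "\<bar>U y - t\<bar> \<le> 1" using scale_in[OF y(1)] t by auto
      ultimately show False using y(2) by linarith
    qed
    then have "\<bar>U y - t\<bar> < d" by (rule e(2)[OF y(1)])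
    moreover have "\<bar>(f \<circ> V) (U y) - (f \<circ> V) t\<bar> \<le> c * \<bar>U y - t\<bar>"
    proof -
      have "K / c \<le> real n"
        using n by (smt (verit) divide_nonneg_nonneg powr_ge_zero)
      then have "K \<le> c * real n" using \<open>0 < c\<close> by (simp add: field_simps)
      have "\<bar>f y - f ?x\<bar> \<le> K * \<bar>y - ?x\<bar> powr \<alpha>" by (rule K(2)[OF y(1) x(1)])
      also have "\<dots> \<le> c * real n * \<bar>y - ?x\<bar> powr \<alpha>"
        using \<open>K \<le> c * real n\<close> by (intro mult_right_mono) auto
      also have "\<dots> = c * (real n * \<bar>y - ?x\<bar> powr \<alpha>)" by simp
      also have "\<dots> \<le> c * \<bar>U y - t\<bar>"
        using y(2) \<open>0 < c\<close> by (intro mult_left_mono) auto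
      finally show ?thesis by (simp add: scale_inv_scale[OF y(1)])
    qed
    ultimately show ?thesis using ne by blast
  qed
  have "(f \<circ> V) t = (f \<circ> V) 0" if "t \<in> {0..1}" for t
    by (rule absolutely_continuous_fun_flat_imp_eq[OF absolutely_continuous_fun_mono[OF ac] _ N flat])
      (use that in auto)
  then have "f x = f 0" if "x \<in> {0..1}" for x
    using that scale_in[OF that] scale_inv_scale[OF that] scale_inv_scale[of 0]
    by (metis atLeastAtMost_iff comp_apply order_refl scale_0 zero_le_one)
  then show False using f(2) unfolding constant_on_def by blast
qed

end

lemma non_atomic_measure_singleton:
  fixes M :: "real measure"
  assumes "finite_measure M" "non_atomic M"
  shows "measure M {x} = 0"
proof (rule ccontr)
  interpret finite_measure M by fact
  assume "measure M {x} \<noteq> 0"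
  then have "0 < emeasure M {x}" by (simp add: emeasure_eq_measure zero_less_measure_iff)
  moreover have "{x} \<in> sets M" using \<open>measure M {x} \<noteq> 0\<close> measure_notin_sets by blast
  ultimately obtain B where "B \<subseteq> {x}" "0 < emeasure M B" "emeasure M B < emeasure M {x}"
    using \<open>non_atomic M\<close> unfolding non_atomic_def by blast
  then show False by (auto dest: subset_singletonD)
qed

theorem theorem1p4:
  fixes \<Lambda> :: "real measure" and \<alpha> :: real
  assumes "radon_measure_on {0..1} \<Lambda>"
    and "prob_space \<Lambda>"
    and "non_atomic \<Lambda>"
    and "full_support_on {0..1} \<Lambda>"
    and "0 < \<alpha>" and "\<alpha> \<le> 1"
  shows "(\<exists>f\<in>form_domain \<Lambda>. \<not> f constant_on {0..1} \<and> holder_continuous \<alpha> f) \<longleftrightarrow>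
         generalized_frostman \<alpha> \<Lambda>"
proof -
  interpret prob_space \<Lambda> by fact
  interpret scale_measure \<Lambda>
  proof
    show "sets \<Lambda> = sets (restrict_space borel {0..1})"
      using assms(1) by (simp add: radon_measure_on_def)
    show "prob {x} = 0" for x
      by (rule non_atomic_measure_singleton[OF finite_measure_axioms \<open>non_atomic \<Lambda>\<close>])
  qed fact
  show ?thesis
    using frostman_if_ex_nonconstant_holder[OF \<open>0 < \<alpha>\<close>] ex_nonconstant_holder_if_frostman[OF \<open>0 < \<alpha>\<close>]
      generalized_frostman_iff[OF \<open>0 < \<alpha>\<close>] by blast
qed

end
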